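(* Let $\mathcal I=(t,m,n,\mathcal X,\mathcal X^{(S)},R)$ be an instance of the ICCSI problem over $\mathbb F_q$, let $\delta\ge0$ be an integer, let $L\in\mathbb F_q^{N\times d_S}$ represent an $\mathbb F_q$-linear Hamming metric $(\mathcal I,\delta)$-ECIC, and fix $i\in[m]$. Let $X\in\mathbb F_q^{n\times t}$ and suppose user $i$ receives $Y_{(i)}=LV^{(S)}X+W_{(i)}\in\mathbb F_q^{N\times t}$, where $W_{(i)}\in\mathbb F_q^{N\times t}$. If $w(W_{(i)})\le\delta$, then the syndrome decoding procedure (Steps I, II, III described in the context), applied to $Y_{(i)}$, has output $\hat X_{d_i+1}=X'_{d_i+1}=R_iX$ (for whichever solution $\varepsilon$ is found in Step II).
   Context: Notation: $q$ is a prime power, $\mathbb F_q$ the field with $q$ elements, $[s]=\{1,\dots,s\}$. For a matrix $A$, $A_i$ is its $i$-th row, $A^j$ its $j$-th column, $A_{\mathcal S}$ and $A^{\mathcal T}$ the submatrices of the rows indexed by $\mathcal S$ and of the columns indexed by $\mathcal T$; $\langle A\rangle$ is its row space. $\overline{[s]}=[n]\setminus[s]$. $w$ is the Hamming weight of a matrix: its number of nonzero rows. $\mathbf e_j$ is the $j$-th standard basis row vector. For $C\subset\mathbb F_q^N$ linear, $C^\perp$ is its dual code; a parity check matrix of $C$ is a matrix whose rows form a basis of $C^\perp$. Instance: positive integers $t,m,n$; subspaces $\mathcal X^{(S)}$ and $\mathcal X^{(i)}$ ($i\in[m]$) of $\mathbb F_q^n$ of dimensions $d_S$ and $d_i$;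 $\mathcal X=\{A\in\mathbb F_q^{m\times n}:A_i\in\mathcal X^{(i)}\}$; a matrix $R\in\mathbb F_q^{m\times n}$ with rows $R_i\in\mathcal X^{(S)}\setminus\mathcal X^{(i)}$. Fix $V^{(S)}\in\mathbb F_q^{d_S\times n}$, $V^{(i)}\in\mathbb F_q^{d_i\times n}$ with $\langle V^{(S)}\rangle=\mathcal X^{(S)}$, $\langle V^{(i)}\rangle=\mathcal X^{(i)}$. ECIC: $L\in\mathbb F_q^{N\times d_S}$ represents an $\mathbb F_q$-linear Hamming metric $(\mathcal I,\delta)$-ECIC if for each $i$ there is a map $D_i:\mathbb F_q^{N\times t}\times\mathbb F_q^{d_i\times t}\to\mathbb F_q^t$ with $D_i(LV^{(S)}X+W,V^{(i)}X)=R_iX$ for all $X\in\mathbb F_q^{n\times t}$ and all $W\in\mathbb F_q^{N\times t}$ with $w(W)\le\delta$. Decoding data at user $i$: $M_{(i)}\in\mathbb F_q^{n\times n}$ is an invertible matrix with $V^{(i)}M_{(i)}=[I\,|\,0]$ ($I$ the $d_i\times d_i$ identity) and $R_iM_{(i)}=\mathbf e_{d_i+1}$. Put $X'=M_{(i)}^{-1}X$; then $X'_{[d_i]}=V^{(i)}X$ is known to user $i$ and $X'_{d_i+1}=R_iX$. Put $L'=LV^{(S)}M_{(i)}\in\mathbb F_q^{N\times n}$. Let $\mathcal C^{(i)}\subset\mathbb F_q^N$ be the column space of $[L'^{\,d_i+1}\,|\,L'^{\,\overline{[d_i+1]}}]$ and $\mathcal C_{(i)}\subset\mathcal C^{(i)}$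 the span of the columns of $L'^{\,\overline{[d_i+1]}}$; one has $\dim\mathcal C^{(i)}=\dim\mathcal C_{(i)}+1$. Let $r_i=\dim\mathcal C_{(i)}^\perp$ and let $$H_{(i)}=\begin{bmatrix}h_{(i)}\\H^{(i)}\end{bmatrix}\in\mathbb F_q^{r_i\times N}$$ be a parity check matrix of $\mathcal C_{(i)}$, where $H^{(i)}$ is a parity check matrix of $\mathcal C^{(i)}$ and $h_{(i)}\in\mathcal C_{(i)}^\perp\setminus(\mathcal C^{(i)})^\perp$. Then $H_{(i)}L'^{\,d_i+1}=[s_{d_i+1},0,\dots,0]^T$ for some $s_{d_i+1}\in\mathbb F_q\setminus\{0\}$. Procedure. Step I: compute $H_{(i)}(Y_{(i)}-L'^{\,[d_i]}X'_{[d_i]})=\begin{bmatrix}\alpha_i\\\beta_i\end{bmatrix}\in\mathbb F_q^{r_i\times t}$, with $\alpha_i\in\mathbb F_q^{1\times t}$, $\beta_i\in\mathbb F_q^{(r_i-1)\times t}$. Step II: find $\varepsilon\in\mathbb F_q^{N\times t}$ with $w(\varepsilon)\le\delta$ and $H^{(i)}\varepsilon=\beta_i$. Step III: output $\hat X_{d_i+1}=(\alpha_i-h_{(i)}\varepsilon)/s_{d_i+1}$. *)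

theory Defs
  imports "Jordan_Normal_Form.VS_Connect" "Jordan_Normal_Form.DL_Submatrix"
begin

(* Rows, columns and users are indexed from 0, so with d = d_i, column d_i + 1 of A is
   col A d, row d_i + 1 is row A d, and the index set {1..d_i} becomes {0..<d}. *)

definition vec_mult_mat :: "'a::semiring_0 vec \<Rightarrow> 'a mat \<Rightarrow> 'a vec" (infixl \<open>\<^sub>v*\<close> 70)
  where "v \<^sub>v* A = vec (dim_col A) (\<lambda>j. v \<bullet> col A j)"

definition hamming_weight :: "'a::zero mat \<Rightarrow> nat"
  where "hamming_weight A = card {k. k < dim_row A \<and> row A k \<noteq> 0\<^sub>v (dim_col A)}"

definition is_subspace :: "nat \<Rightarrow> 'a::field vec set \<Rightarrow> bool"
  where "is_subspace n U \<longleftrightarrow> VectorSpace.subspace class_ring U (module_vec TYPE('a) n)"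

definition vec_dim :: "nat \<Rightarrow> 'a::field vec set \<Rightarrow> nat"
  where "vec_dim n U =
    vectorspace.dim class_ring ((module_vec TYPE('a) n)\<lparr>carrier := U\<rparr>)"

definition dual_code :: "nat \<Rightarrow> 'a::field vec set \<Rightarrow> 'a vec set"
  where "dual_code N C = {x \<in> carrier_vec N. \<forall>c\<in>C. x \<bullet> c = 0}"

definition parity_check_mat :: "nat \<Rightarrow> 'a::field vec set \<Rightarrow> 'a mat \<Rightarrow> bool"
  where "parity_check_mat N C H \<longleftrightarrow> dim_col H = N \<and> distinct (rows H) \<and>
    vectorspace.basis class_ring ((module_vec TYPE('a) N)\<lparr>carrier := dual_code N C\<rparr>)
      (set (rows H))"

(* Xu i is the side information space of user i; XX is the paper's calligraphic X.
   The dimensions d_S and d_i are vec_dim n XS and vec_dim n (Xu i). *)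
definition iccsi_instance ::
  "nat \<Rightarrow> nat \<Rightarrow> nat \<Rightarrow> 'a::field mat set \<Rightarrow> 'a vec set \<Rightarrow> (nat \<Rightarrow> 'a vec set) \<Rightarrow> 'a mat \<Rightarrow> bool"
  where "iccsi_instance t m n XX XS Xu R \<longleftrightarrow>
    0 < t \<and> 0 < m \<and> 0 < n \<and>
    is_subspace n XS \<and> (\<forall>i<m. is_subspace n (Xu i)) \<and>
    XX = {A \<in> carrier_mat m n. \<forall>i<m. row A i \<in> Xu i} \<and>
    R \<in> carrier_mat m n \<and> (\<forall>i<m. row R i \<in> XS - Xu i)"

definition spanning_mat :: "nat \<Rightarrow> 'a::field vec set \<Rightarrow> 'a mat \<Rightarrow> bool"
  where "spanning_mat n U V \<longleftrightarrow> V \<in> carrier_mat (vec_dim n U) n \<and> vec_space.row_space n V = U"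

definition represents_ecic ::
  "nat \<Rightarrow> nat \<Rightarrow> nat \<Rightarrow> 'a::field vec set \<Rightarrow> (nat \<Rightarrow> 'a vec set) \<Rightarrow> 'a mat \<Rightarrow>
   'a mat \<Rightarrow> (nat \<Rightarrow> 'a mat) \<Rightarrow> nat \<Rightarrow> nat \<Rightarrow> 'a mat \<Rightarrow> bool"
  where "represents_ecic t m n XS Xu R VS V N \<delta> L \<longleftrightarrow>
    L \<in> carrier_mat N (vec_dim n XS) \<and>
    (\<forall>i<m. \<exists>D \<in> carrier_mat N t \<times> carrier_mat (vec_dim n (Xu i)) t \<rightarrow> carrier_vec t.
       \<forall>X \<in> carrier_mat n t. \<forall>W \<in> carrier_mat N t. hamming_weight W \<le> \<delta> \<longrightarrow>
         D (L * VS * X + W, V i * X) = row R i \<^sub>v* X)"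

definition stack_row :: "'a::zero vec \<Rightarrow> 'a mat \<Rightarrow> 'a mat"
  where "stack_row h H' = mat_of_row h @\<^sub>r H'"

(* Columns d, ..., n - 1 and d + 1, ..., n - 1 of L': the codes with upper, resp. lower,
   index i in the paper, for d = d_i. *)
definition code_up :: "nat \<Rightarrow> nat \<Rightarrow> 'a::field mat \<Rightarrow> 'a vec set"
  where "code_up N d L' = vec_space.col_space N (submatrix L' UNIV {d..<dim_col L'})"

definition code_low :: "nat \<Rightarrow> nat \<Rightarrow> 'a::field mat \<Rightarrow> 'a vec set"
  where "code_low N d L' = vec_space.col_space N (submatrix L' UNIV {Suc d..<dim_col L'})"

(* The set of all outputs the procedure can produce on the received matrix Y and the known
   rows K of X', over all solutions \<epsilon> of Step II.  It is empty iff Step II has no solution.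
   That s is nonzero, and is the only nonzero entry of [h; H'] *\<^sub>v col L' d, follows from the
   conditions on h and H'; see lemma syndrome_column. *)
definition syndrome_outputs ::
  "nat \<Rightarrow> nat \<Rightarrow> 'a::field mat \<Rightarrow> 'a vec \<Rightarrow> 'a mat \<Rightarrow> 'a mat \<Rightarrow> 'a mat \<Rightarrow> 'a vec set"
  where "syndrome_outputs \<delta> d L' h H' Y K =
    (let H = stack_row h H';
         S = H * (Y - submatrix L' UNIV {0..<d} * K);
         \<alpha> = row S 0;
         \<beta> = submatrix S {1..<dim_row S} UNIV;
         s = (H *\<^sub>v col L' d) $ 0
     in {(1 / s) \<cdot>\<^sub>v (\<alpha> - h \<^sub>v* \<epsilon>) | \<epsilon>.
           \<epsilon> \<in> carrier_mat (dim_row Y) (dim_col Y) \<and> hamming_weight \<epsilon> \<le> \<delta> \<and> H' * \<epsilon> = \<beta>})"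

lemma set_cols_submatrix:
  "set (cols (submatrix A UNIV J)) = col A ` {j. j < dim_col A \<and> j \<in> J}"
proof -
  let ?B = "submatrix A UNIV J"
  have dims: "dim_row ?B = dim_row A" "dim_col ?B = card {j. j < dim_col A \<and> j \<in> J}"
    by (simp_all add: dim_submatrix)
  have c: "col ?B k = col A (pick J k)"
    if k: "k < card {j. j < dim_col A \<and> j \<in> J}" for k
    using k pick_le[OF k]
    by (intro eq_vecI) (simp_all add: dims submatrix_index pick_UNIV)
  show ?thesis
  proof (intro equalityI subsetI)
    fix x assume "x \<in> set (cols ?B)"
    then obtain k where k: "k < card {j. j < dim_col A \<and> j \<in> J}" and x: "x = col ?B k"
      by (auto simp: cols_def dims)
    have "pick J k < dim_col A" using pick_le[OF k] .
    moreover have "pick J k \<in> J"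
    proof (rule pick_in_set)
      show "k < card J \<or> infinite J"
        using k card_mono[of J "{j. j < dim_col A \<and> j \<in> J}"] by fastforce
    qed
    ultimately show "x \<in> col A ` {j. j < dim_col A \<and> j \<in> J}" using c[OF k] x by auto
  next
    fix x assume "x \<in> col A ` {j. j < dim_col A \<and> j \<in> J}"
    then obtain j where j: "j < dim_col A" "j \<in> J" and x: "x = col A j" by auto
    let ?k = "card {a \<in> J. a < j}"
    have "{a \<in> J. a < j} \<subset> {j. j < dim_col A \<and> j \<in> J}" using j by auto
    then have k: "?k < card {j. j < dim_col A \<and> j \<in> J}" by (simp add: psubset_card_mono)
    have "x = col ?B ?k" using c[OF k] pick_card_in_set[OF j(2)] x by simp
    then show "x \<in> set (cols ?B)" using k by (auto simp: cols_def dims)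
  qed
qed

lemma dual_code_col_space:
  fixes A :: "'a::field mat"
  assumes A: "A \<in> carrier_mat N nc"
  shows "dual_code N (vec_space.col_space N A) =
    {x \<in> carrier_vec N. \<forall>c \<in> set (cols A). x \<bullet> c = 0}"
proof -
  have "set (cols A) \<subseteq> carrier_vec N" using A cols_dim by blast
  from vec_space.in_orthogonal_complement_span[OF this]
  show ?thesis
    unfolding dual_code_def vec_space.col_space_def vec_module.orthogonal_complement_def by simp
qed

lemma dual_code_vectorspace:
  fixes C :: "'a::field vec set"
  assumes C: "C \<subseteq> carrier_vec N"
  shows "vectorspace class_ring ((module_vec TYPE('a) N)\<lparr>carrier := dual_code N C\<rparr>)"
proof -
  interpret vec_space "TYPE('a)" N .
  have 1: "(x + y) \<bullet> c = 0" if "x \<in> dual_code N C" "y \<in> dual_code N C" "c \<in> C" for x y c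
    using that C by (subst add_scalar_prod_distrib[of _ N]) (auto simp: dual_code_def)
  have 2: "(a \<cdot>\<^sub>v x) \<bullet> c = 0" if "x \<in> dual_code N C" "c \<in> C" for a x c
    using that C by (subst smult_scalar_prod_distrib[of _ N]) (auto simp: dual_code_def)
  have 3: "0\<^sub>v N \<in> dual_code N C"
    using C by (auto simp: dual_code_def)
  have "submodule class_ring (dual_code N C) V"
    unfolding submodule_def
    using 1 2 3 module_axioms by (auto simp: dual_code_def)
  then show ?thesis
    by (intro subspace_is_vs) (simp add: VectorSpace.subspace_def vectorspace_axioms)
qed

lemma syndrome_column:
  fixes L' H' :: "'a::field mat"
  assumes L': "L' \<in> carrier_mat N n" and d: "d < n"
    and h: "h \<in> dual_code N (code_low N d L') - dual_code N (code_up N d L')"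
    and H': "parity_check_mat N (code_up N d L') H'"
  shows "\<exists>s. s \<noteq> 0 \<and>
    stack_row h H' *\<^sub>v col L' d = s \<cdot>\<^sub>v unit_vec (Suc (dim_row H')) 0"
proof -
  have sub: "submatrix L' UNIV J \<in> carrier_mat N (card {j. j < n \<and> j \<in> J})" for J
    using L' by (auto simp: submatrix_def)
  have dual: "dual_code N (vec_space.col_space N (submatrix L' UNIV J)) =
      {x \<in> carrier_vec N. \<forall>j. j < n \<and> j \<in> J \<longrightarrow> x \<bullet> col L' j = 0}" for J
    using L' by (auto simp: dual_code_col_space[OF sub] set_cols_submatrix)
  have hN: "h \<in> carrier_vec N" and nz: "h \<bullet> col L' d \<noteq> 0"
    using h L' unfolding code_low_def code_up_def dual by (auto simp: le_less Suc_le_eq)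
  have colH': "dim_col H' = N" and "set (rows H') \<subseteq> dual_code N (code_up N d L')"
  proof -
    have up: "code_up N d L' \<subseteq> carrier_vec N"
      using sub[of "{d..<dim_col L'}"]
      unfolding code_up_def vec_space.col_space_eq[OF sub] by (metis (no_types, lifting)
        carrier_matD(1) mem_Collect_eq subsetI)
    note vs = dual_code_vectorspace[OF up]
    show "dim_col H' = N" "set (rows H') \<subseteq> dual_code N (code_up N d L')"
      using H' unfolding parity_check_mat_def vectorspace.basis_def[OF vs] by auto
  qed
  then have r: "row H' k \<bullet> col L' d = 0" if "k < dim_row H'" for k
    using that d L' unfolding code_up_def dual by (auto simp: rows_def image_subset_iff)
  have "stack_row h H' *\<^sub>v col L' d = (h \<bullet> col L' d) \<cdot>\<^sub>v unit_vec (Suc (dim_row H')) 0"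
    (is "?l = ?r")
  proof (rule eq_vecI)
    fix k assume k: "k < dim_vec ?r"
    show "?l $ k = ?r $ k"
    proof (cases k)
      case 0
      have "row (stack_row h H') 0 = h"
        using hN colH' by (intro eq_vecI)
          (auto simp: stack_row_def append_rows_def mat_of_row_def)
      with 0 show ?thesis
        by (simp add: stack_row_def append_rows_def mat_of_row_def)
    next
      case (Suc l)
      then have "l < dim_row H'" using k by simp
      moreover have "row (stack_row h H') (Suc l) = row H' l"
        using hN colH' \<open>l < dim_row H'\<close> by (intro eq_vecI)
          (auto simp: stack_row_def append_rows_def mat_of_row_def)
      ultimately show ?thesis using Suc r k
        by (simp add: stack_row_def append_rows_def mat_of_row_def)
    qed
  qed (simp add: stack_row_def append_rows_def mat_of_row_def)
  with nz show ?thesis by blast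
qed

end

theory Submission
  imports Defs
begin

text \<open>Put \<open>d = d\<^sub>i\<close> and let \<open>\<epsilon>\<close> be a solution of Step II. The known rows of \<open>X'\<close> are subtracted
  from the received matrix, and \<open>H'\<close> annihilates the columns of \<open>L'\<close> from \<open>d\<close> on, so
  \<open>H' * \<epsilon> = H' * W\<close>. By biduality, \<open>W - \<epsilon> = L' * P\<close> where the first \<open>d\<close> rows of \<open>P\<close>
  vanish. The messages \<open>M * P\<close> with error \<open>\<epsilon>\<close> and \<open>0\<close> with error \<open>W\<close> then give user \<open>i\<close> the same
  data, so the code forces row \<open>d\<close> of \<open>P\<close>, the demand for \<open>M * P\<close>, to vanish as well.
  Hence the columns of \<open>W - \<epsilon>\<close> lie in the smaller code, and \<open>h\<close> does not see the difference.\<close>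

section \<open>Pairing with column combinations, and biduality\<close>

lemma scalar_prod_mult_mat_vec:
  fixes A :: "'a::comm_semiring_0 mat"
  assumes "A \<in> carrier_mat N n" "y \<in> carrier_vec N" "p \<in> carrier_vec n"
  shows "y \<bullet> (A *\<^sub>v p) = (\<Sum>j<n. p $ j * (y \<bullet> col A j))"
proof -
  have "y \<bullet> (A *\<^sub>v p) = (\<Sum>a<N. \<Sum>j<n. y $ a * (A $$ (a, j) * p $ j))"
    using assms by (simp add: scalar_prod_def sum_distrib_left atLeast0LessThan)
  also have "\<dots> = (\<Sum>j<n. \<Sum>a<N. y $ a * (A $$ (a, j) * p $ j))"
    by (rule sum.swap)
  also have "\<dots> = (\<Sum>j<n. p $ j * (y \<bullet> col A j))"
    using assms
    by (intro sum.cong refl)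
       (simp add: scalar_prod_def sum_distrib_left atLeast0LessThan mult_ac)
  finally show ?thesis .
qed

text \<open>Biduality with explicit coefficients supported on \<open>J\<close>, by induction on
  \<open>J\<close> instead of a dimension count. If every vector annihilating the columns in
  \<open>J\<close> also annihilates column \<open>a\<close>, that column is redundant. Otherwise
  some \<open>z\<close> separates it, and a suitable multiple of column \<open>a\<close> can be
  split off from \<open>x\<close>.\<close>

lemma biorthogonal_imp_combination_of_cols:
  fixes A :: "'a::field mat"
  assumes A: "A \<in> carrier_mat N n" and J: "J \<subseteq> {..<n}" and x: "x \<in> carrier_vec N"
    and orth: "\<And>y. y \<in> carrier_vec N \<Longrightarrow> \<forall>j\<in>J. y \<bullet> col A j = 0 \<Longrightarrow> y \<bullet> x = 0"
  shows "\<exists>p\<in>carrier_vec n. x = A *\<^sub>v p \<and> (\<forall>j<n. j \<notin> J \<longrightarrow> p $ j = 0)"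
proof -
  have "finite J" using J finite_subset by blast
  then show ?thesis using J x orth
  proof (induction J arbitrary: x)
    case empty
    have "x = 0\<^sub>v N"
    proof (rule eq_vecI)
      fix k assume k: "k < dim_vec (0\<^sub>v N :: 'a vec)"
      then show "x $ k = 0\<^sub>v N $ k"
        \<comment> \<open>With no columns there is no constraint on \<open>y\<close>, so the unit
          vectors read off that all coordinates of \<open>x\<close> are 0.\<close>
        using empty.prems(3)[of "unit_vec N k"] empty.prems(2) by simp
    qed (use empty.prems in auto)
    then show ?case using A by (intro bexI[of _ "0\<^sub>v n"]) auto
  next
    case (insert a J)
    have a: "a < n" and ca: "col A a \<in> carrier_vec N" using insert.prems(1) A by auto
    note x = insert.prems(2)
    show ?case
    proof (cases "\<forall>y\<in>carrier_vec N. (\<forall>j\<in>J. y \<bullet> col A j = 0) \<longrightarrow> y \<bullet> col A a = 0")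
      case True
      have "\<exists>p\<in>carrier_vec n. x = A *\<^sub>v p \<and> (\<forall>j<n. j \<notin> J \<longrightarrow> p $ j = 0)"
        using insert.prems True by (intro insert.IH) auto
      then show ?thesis by auto
    next
      case False
      then obtain z where z: "z \<in> carrier_vec N" "\<forall>j\<in>J. z \<bullet> col A j = 0" "z \<bullet> col A a \<noteq> 0"
        by auto
      \<comment> \<open>The multiple of column \<open>a\<close> whose removal makes \<open>x\<close>
        orthogonal to \<open>z\<close>.\<close>
      define c where "c = (z \<bullet> x) / (z \<bullet> col A a)"
      have "\<exists>p\<in>carrier_vec n. x - c \<cdot>\<^sub>v col A a = A *\<^sub>v p \<and> (\<forall>j<n. j \<notin> J \<longrightarrow> p $ j = 0)"
      proof (rule insert.IH)
        fix y :: "'a vec" assume y: "y \<in> carrier_vec N" "\<forall>j\<in>J. y \<bullet> col A j = 0"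
        \<comment> \<open>Subtracting \<open>b\<close> times \<open>z\<close> makes \<open>y\<close>
          annihilate column \<open>a\<close> as well, while the columns in \<open>J\<close> stay
          annihilated. The hypothesis on \<open>x\<close> then applies to the corrected
          vector.\<close>
        define b where "b = (y \<bullet> col A a) / (z \<bullet> col A a)"
        have *: "(y - b \<cdot>\<^sub>v z) \<bullet> u = y \<bullet> u - b * (z \<bullet> u)" if "u \<in> carrier_vec N" for u
          using that y z by (simp add: minus_scalar_prod_distrib[of _ N])
        have ba: "b * (z \<bullet> col A a) = y \<bullet> col A a" using z by (simp add: b_def)
        have "(y - b \<cdot>\<^sub>v z) \<bullet> x = 0"
        proof (rule insert.prems(3))
          show "\<forall>j\<in>insert a J. (y - b \<cdot>\<^sub>v z) \<bullet> col A j = 0"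
          proof
            fix j assume j: "j \<in> insert a J"
            then have "col A j \<in> carrier_vec N" using insert.prems(1) A by auto
            then show "(y - b \<cdot>\<^sub>v z) \<bullet> col A j = 0" using j y z ba * by auto
          qed
        qed (use y z in auto)
        then have "y \<bullet> x = b * (z \<bullet> x)" using * x by simp
        then show "y \<bullet> (x - c \<cdot>\<^sub>v col A a) = 0"
          using x y z ca
          by (simp add: scalar_prod_minus_distrib[of _ N] b_def c_def)
      qed (use insert.prems ca in auto)
      then obtain p where p: "p \<in> carrier_vec n" "x - c \<cdot>\<^sub>v col A a = A *\<^sub>v p"
        "\<forall>j<n. j \<notin> J \<longrightarrow> p $ j = 0" by auto
      have "A *\<^sub>v unit_vec n a = col A a" using A a by (intro eq_vecI) auto
      then have "A *\<^sub>v (p + c \<cdot>\<^sub>v unit_vec n a) = A *\<^sub>v p + c \<cdot>\<^sub>v col A a"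
        using A p(1) a
        by (simp add: mult_add_distrib_mat_vec[of _ N n] mult_mat_vec[of _ N n])
      also have "\<dots> = x"
        unfolding p(2)[symmetric] using x A by (intro eq_vecI) auto
      finally have "x = A *\<^sub>v (p + c \<cdot>\<^sub>v unit_vec n a)" ..
      then show ?thesis
        using p a by (intro bexI[of _ "p + c \<cdot>\<^sub>v unit_vec n a"]) auto
    qed
  qed
qed

section \<open>Dual codes of column sets and their parity check matrices\<close>

lemma dual_code_submatrix_cols:
  fixes A :: "'a::field mat"
  assumes A: "A \<in> carrier_mat N n"
  shows "dual_code N (vec_space.col_space N (submatrix A UNIV J)) =
    {y \<in> carrier_vec N. \<forall>j<n. j \<in> J \<longrightarrow> y \<bullet> col A j = 0}"
proof -
  have "submatrix A UNIV J \<in> carrier_mat N (card {j. j < n \<and> j \<in> J})"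
    using A by (auto simp: submatrix_def)
  from dual_code_col_space[OF this] show ?thesis
    using A by (auto simp: set_cols_submatrix)
qed

lemma col_space_carrier:
  fixes A :: "'a::field mat"
  shows "A \<in> carrier_mat N n \<Longrightarrow> vec_space.col_space N A \<subseteq> carrier_vec N"
  by (auto simp: vec_space.col_space_eq)

lemma col_space_submatrix_carrier:
  fixes A :: "'a::field mat"
  assumes A: "A \<in> carrier_mat N n"
  shows "vec_space.col_space N (submatrix A UNIV J) \<subseteq> carrier_vec N"
proof (rule col_space_carrier)
  show "submatrix A UNIV J \<in> carrier_mat N (card {j. j < n \<and> j \<in> J})"
    using A by (auto simp: submatrix_def)
qed

lemma parity_check_mat_dim_col: "parity_check_mat N C H \<Longrightarrow> dim_col H = N"
  by (simp add: parity_check_mat_def)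

text \<open>The definition speaks of a basis of the dual code as a vector space of its own. Since
  the dual code is a submodule, the span of the rows is the same in the ambient space, where facts
  on orthogonal complements apply.\<close>

lemma parity_check_mat_span_rows:
  fixes H :: "'a::field mat"
  assumes C: "C \<subseteq> carrier_vec N" and H: "parity_check_mat N C H"
  shows "LinearCombinations.module.span class_ring (module_vec TYPE('a) N) (set (rows H))
    = dual_code N C"
proof -
  interpret vec_space "TYPE('a)" N .
  have 1: "(x + y) \<bullet> c = 0" if "x \<in> dual_code N C" "y \<in> dual_code N C" "c \<in> C" for x y c
    using that C by (subst add_scalar_prod_distrib[of _ N]) (auto simp: dual_code_def)
  have 2: "(a \<cdot>\<^sub>v x) \<bullet> c = 0" if "x \<in> dual_code N C" "c \<in> C" for a x c
    using that C by (subst smult_scalar_prod_distrib[of _ N]) (auto simp: dual_code_def)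
  have 3: "0\<^sub>v N \<in> dual_code N C"
    using C by (auto simp: dual_code_def)
  have sub: "submodule class_ring (dual_code N C) V"
    unfolding submodule_def
    using 1 2 3 module_axioms by (auto simp: dual_code_def)
  note vs = dual_code_vectorspace[OF C]
  have b: "set (rows H) \<subseteq> dual_code N C"
    "LinearCombinations.module.span class_ring (V\<lparr>carrier := dual_code N C\<rparr>) (set (rows H))
      = dual_code N C"
    using H unfolding parity_check_mat_def vectorspace.basis_def[OF vs] by auto
  show ?thesis using span_li_not_depend(1)[OF b(1) sub] b(2) by simp
qed

text \<open>Orthogonality to a spanning set is orthogonality to its span. This turns a zero syndrome
  into the hypothesis of biduality.\<close>

lemma parity_check_mat_orthogonal:
  fixes H :: "'a::field mat"
  assumes C: "C \<subseteq> carrier_vec N" and H: "parity_check_mat N C H" and x: "x \<in> carrier_vec N"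
  shows "(\<forall>y\<in>dual_code N C. y \<bullet> x = 0) \<longleftrightarrow> (\<forall>k<dim_row H. row H k \<bullet> x = 0)"
proof -
  interpret vec_space "TYPE('a)" N .
  have rows: "set (rows H) \<subseteq> carrier_vec N"
    using parity_check_mat_dim_col[OF H] rows_carrier by blast
  have comm: "y \<bullet> x = x \<bullet> y" if "y \<in> carrier_vec N" for y
    using that x comm_scalar_prod by blast
  have "(\<forall>y\<in>dual_code N C. y \<bullet> x = 0) \<longleftrightarrow> (\<forall>y\<in>span (set (rows H)). x \<bullet> y = 0)"
    unfolding parity_check_mat_span_rows[OF C H] by (auto simp: dual_code_def comm)
  also have "\<dots> \<longleftrightarrow> (\<forall>y\<in>set (rows H). x \<bullet> y = 0)"
    using in_orthogonal_complement_span[OF rows] x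
    unfolding orthogonal_complement_def by blast
  also have "\<dots> \<longleftrightarrow> (\<forall>k<dim_row H. row H k \<bullet> x = 0)"
    using rows comm by (auto simp: rows_def image_subset_iff)
  finally show ?thesis .
qed

section \<open>Submatrix products, row vectors and stacked matrices\<close>

lemma submatrix_cols_mult_submatrix_rows:
  fixes A B :: "'a::semiring_0 mat"
  assumes A: "A \<in> carrier_mat N n" and B: "B \<in> carrier_mat n t" and d: "d \<le> n"
  shows "submatrix A UNIV {0..<d} * submatrix B {0..<d} UNIV =
    A * mat n t (\<lambda>(j, c). if j < d then B $$ (j, c) else 0)"
proof -
  have [simp]: "pick {0..<d} k = k" if "k < d" for k
  proof -
    have "{a \<in> {0..<d}. a < k} = {..<k}" using that by auto
    then show ?thesis using pick_card_in_set[of k "{0..<d}"] that by simp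
  qed
  have [simp]: "{j. j < n \<and> j < d} = {..<d}" using d by auto
  have sA: "submatrix A UNIV {0..<d} = mat N d (\<lambda>(a, j). A $$ (a, j))"
    and sB: "submatrix B {0..<d} UNIV = mat d t (\<lambda>(j, c). B $$ (j, c))"
    using A B by (auto simp: submatrix_def pick_UNIV)
  show ?thesis
  proof (rule eq_matI)
    fix a c assume "a < dim_row (A * mat n t (\<lambda>(j, c). if j < d then B $$ (j, c) else 0))"
      "c < dim_col (A * mat n t (\<lambda>(j, c). if j < d then B $$ (j, c) else 0))"
    then have ac: "a < N" "c < t" using A by auto
    have "(\<Sum>j<d. A $$ (a, j) * B $$ (j, c)) =
        (\<Sum>j<n. A $$ (a, j) * (if j < d then B $$ (j, c) else 0))"
      using d by (intro sum.mono_neutral_cong_left) auto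
    then show "(submatrix A UNIV {0..<d} * submatrix B {0..<d} UNIV) $$ (a, c) =
        (A * mat n t (\<lambda>(j, c). if j < d then B $$ (j, c) else 0)) $$ (a, c)"
      using ac A unfolding sA sB by (simp add: scalar_prod_def atLeast0LessThan)
  qed (use A B in \<open>auto simp: sA sB\<close>)
qed

lemma submatrix_drop_first_row:
  assumes A: "A \<in> carrier_mat (Suc r) t"
  shows "submatrix A {1..<Suc r} UNIV = mat r t (\<lambda>(k, c). A $$ (Suc k, c))"
proof -
  have I: "{k. k < Suc r \<and> k \<in> {1..<Suc r}} = {1..<Suc r}" by auto
  \<comment> \<open>The set starts at 1, so its element with exactly \<open>k\<close> predecessors
    is \<open>Suc k\<close>.\<close>
  have pick: "pick {1..<Suc r} k = Suc k" if "k < r" for k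
  proof -
    have "{a \<in> {1..<Suc r}. a < Suc k} = {1..<Suc k}" using that by auto
    moreover have "pick {1..<Suc r} (card {a \<in> {1..<Suc r}. a < Suc k}) = Suc k"
      by (rule pick_card_in_set) (use that in auto)
    ultimately show ?thesis by simp
  qed
  show ?thesis
    unfolding submatrix_def carrier_matD[OF A] I
    by (intro cong_mat) (simp_all only: card_atLeastLessThan diff_Suc_1 pick pick_UNIV
        UNIV_I simp_thms card_Collect_less_nat split)
qed

lemma vec_mult_mat_assoc:
  fixes A B :: "'a::comm_semiring_0 mat"
  assumes v: "v \<in> carrier_vec k" and A: "A \<in> carrier_mat k n" and B: "B \<in> carrier_mat n t"
  shows "v \<^sub>v* A \<^sub>v* B = v \<^sub>v* (A * B)"
proof (rule eq_vecI)
  fix c assume "c < dim_vec (v \<^sub>v* (A * B))"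
  then have c: "c < t" using B by (simp add: vec_mult_mat_def)
  have "v \<bullet> (A *\<^sub>v col B c) = (\<Sum>j<n. B $$ (j, c) * (v \<bullet> col A j))"
    using scalar_prod_mult_mat_vec[OF A v, of "col B c"] B c by simp
  moreover have "col (A * B) c = A *\<^sub>v col B c" using A B c by (intro eq_vecI) auto
  ultimately show "(v \<^sub>v* A \<^sub>v* B) $ c = (v \<^sub>v* (A * B)) $ c"
    using A B c by (simp add: vec_mult_mat_def scalar_prod_def atLeast0LessThan mult.commute)
qed (simp add: vec_mult_mat_def)

lemma unit_vec_mult_mat:
  fixes A :: "'a::semiring_1 mat"
  assumes "A \<in> carrier_mat n t" "d < n"
  shows "unit_vec n d \<^sub>v* A = row A d"
  using assms by (intro eq_vecI) (simp_all add: vec_mult_mat_def)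

lemma stack_row_dim [simp]:
  "dim_row (stack_row h H') = Suc (dim_row H')"
  by (simp add: stack_row_def append_rows_def mat_of_row_def)

lemma row_stack_row:
  assumes "h \<in> carrier_vec N" "dim_col H' = N"
  shows "row (stack_row h H') 0 = h"
    and "k < dim_row H' \<Longrightarrow> row (stack_row h H') (Suc k) = row H' k"
  using assms
  by (auto simp: stack_row_def append_rows_def mat_of_row_def intro!: eq_vecI)

theorem theoremV2:
  fixes t m n N \<delta> i d :: nat
    and XX :: "'a::{field,finite} mat set"
    and XS :: "'a vec set" and Xu :: "nat \<Rightarrow> 'a vec set"
    and R VS L M Minv L' H' X X' W Y :: "'a mat" and V :: "nat \<Rightarrow> 'a mat"
    and h :: "'a vec"
  assumes inst: "iccsi_instance t m n XX XS Xu R"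
    and VS: "spanning_mat n XS VS"
    and V: "\<forall>j<m. spanning_mat n (Xu j) (V j)"
    and ecic: "represents_ecic t m n XS Xu R VS V N \<delta> L"
    and i: "i < m"
    and d: "d = vec_dim n (Xu i)"
    and M: "M \<in> carrier_mat n n" "Minv \<in> carrier_mat n n" "inverts_mat M Minv" "inverts_mat Minv M"
    and VM: "V i * M = mat d n (\<lambda>(a, b). if a = b then 1 else 0)"
    and RM: "row R i \<^sub>v* M = unit_vec n d"
    and L': "L' = L * VS * M"
    and h: "h \<in> dual_code N (code_low N d L') - dual_code N (code_up N d L')"
    and H': "parity_check_mat N (code_up N d L') H'"
    and H: "parity_check_mat N (code_low N d L') (stack_row h H')"
    and X: "X \<in> carrier_mat n t"
    and X': "X' = Minv * X"
    and W: "W \<in> carrier_mat N t"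
    and Y: "Y = L * VS * X + W"
    and weight: "hamming_weight W \<le> \<delta>"
  shows "syndrome_outputs \<delta> d L' h H' Y (submatrix X' {0..<d} UNIV) = {row X' d} \<and>
         row X' d = row R i \<^sub>v* X"
proof -

  \<comment> \<open>Dimensions and the change of basis at user \<open>i\<close>\<close>
  let ?dS = "vec_dim n XS"
  have R: "R \<in> carrier_mat m n" and Xi: "is_subspace n (Xu i)" and RX: "row R i \<notin> Xu i"
    using inst i by (auto simp: iccsi_instance_def)
  have VSc: "VS \<in> carrier_mat ?dS n" using VS by (simp add: spanning_mat_def)
  have Vc: "V i \<in> carrier_mat d n" using V i d by (simp add: spanning_mat_def)
  have Lc: "L \<in> carrier_mat N ?dS" using ecic by (simp add: represents_ecic_def)
  have "\<exists>D \<in> carrier_mat N t \<times> carrier_mat (vec_dim n (Xu i)) t \<rightarrow> carrier_vec t.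
      \<forall>X \<in> carrier_mat n t. \<forall>W \<in> carrier_mat N t. hamming_weight W \<le> \<delta> \<longrightarrow>
        D (L * VS * X + W, V i * X) = row R i \<^sub>v* X"
    using ecic i unfolding represents_ecic_def by simp
  then obtain D where D: "\<forall>X \<in> carrier_mat n t. \<forall>W \<in> carrier_mat N t.
      hamming_weight W \<le> \<delta> \<longrightarrow> D (L * VS * X + W, V i * X) = row R i \<^sub>v* X"
    by (elim bexE)
  have Rc: "row R i \<in> carrier_vec n" using R i by auto
  note Mc = M(1) and Mic = M(2)
  have MMi: "M * Minv = 1\<^sub>m n" using M by (simp add: inverts_mat_def)
  have LVc: "L * VS \<in> carrier_mat N n" using Lc VSc by simp
  have L'c: "L' \<in> carrier_mat N n" using LVc Mc L' by simp
  have X'c: "X' \<in> carrier_mat n t" using X X' Mic by auto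

  have Rrow: "row R i = unit_vec n d \<^sub>v* Minv"
  proof -
    have "unit_vec n d \<^sub>v* Minv = row R i \<^sub>v* (M * Minv)"
      unfolding RM[symmetric] by (rule vec_mult_mat_assoc[OF Rc Mc Mic])
    also have "\<dots> = row R i" unfolding MMi using Rc R
      by (intro eq_vecI) (auto simp: vec_mult_mat_def simp del: row_carrier)
    finally show ?thesis ..
  qed
  \<comment> \<open>For an index out of range \<open>unit_vec\<close> is the zero vector. The demand
    of user \<open>i\<close> would then be 0, which lies in every side information space.\<close>
  have dn: "d < n"
  proof (rule ccontr)
    assume "\<not> d < n"
    then have "unit_vec n d = (0\<^sub>v n :: 'a vec)" by (intro eq_vecI) (auto simp: unit_vec_def)
    then have "row R i = 0\<^sub>v n" using Mic unfolding Rrow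
      by (intro eq_vecI) (auto simp: vec_mult_mat_def)
    moreover have "0\<^sub>v n \<in> Xu i"
      using Xi unfolding is_subspace_def VectorSpace.subspace_def submodule_def
      by (auto simp: module_vec_simps)
    ultimately show False using RX by simp
  qed
  have rowX': "row X' d = row R i \<^sub>v* X"
  proof -
    have "row R i \<^sub>v* X = unit_vec n d \<^sub>v* X'"
      unfolding Rrow X' by (rule vec_mult_mat_assoc[OF _ Mic X]) simp
    then show ?thesis using unit_vec_mult_mat[OF X'c dn] by simp
  qed

  \<comment> \<open>The two dual codes and the action of \<open>h\<close> and
    \<open>H'\<close>\<close>
  have up: "dual_code N (code_up N d L') =
      {y \<in> carrier_vec N. \<forall>j<n. d \<le> j \<longrightarrow> y \<bullet> col L' j = 0}"
    using L'c unfolding code_up_def by (subst dual_code_submatrix_cols[OF L'c]) auto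
  have low: "dual_code N (code_low N d L') =
      {y \<in> carrier_vec N. \<forall>j<n. d < j \<longrightarrow> y \<bullet> col L' j = 0}"
    using L'c unfolding code_low_def by (subst dual_code_submatrix_cols[OF L'c]) auto
  have up_carrier: "code_up N d L' \<subseteq> carrier_vec N"
    unfolding code_up_def by (rule col_space_submatrix_carrier[OF L'c])
  have hN: "h \<in> carrier_vec N" and hlow: "\<And>j. j < n \<Longrightarrow> d < j \<Longrightarrow> h \<bullet> col L' j = 0"
    using h unfolding low by auto
  define s where "s = h \<bullet> col L' d"
  \<comment> \<open>Membership in the two dual codes differs only in the condition at column
    \<open>d\<close>, so this is the condition that \<open>h\<close> violates.\<close>
  have s: "s \<noteq> 0"
    using h unfolding low up s_def by (auto simp: le_less)
  have H'N: "dim_col H' = N" by (rule parity_check_mat_dim_col[OF H'])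
  have H'c: "H' \<in> carrier_mat (dim_row H') N" using H'N by auto
  note H'up = parity_check_mat_orthogonal[OF up_carrier H']
  have rowH': "row H' k \<in> carrier_vec N" for k using H'N by auto

  \<comment> \<open>Columns before \<open>d\<close> have coefficient 0 and those after
    \<open>d\<close> are annihilated by \<open>h\<close>. Only column \<open>d\<close> survives, so
    \<open>h\<close> reads off the demanded coordinate up to the factor \<open>s\<close>.\<close>
  have h_lin: "h \<bullet> (L' *\<^sub>v p) = p $ d * s" if p: "p \<in> carrier_vec n" "\<And>j. j < d \<Longrightarrow> p $ j = 0" for p
  proof -
    have "h \<bullet> (L' *\<^sub>v p) = (\<Sum>j<n. p $ j * (h \<bullet> col L' j))"
      by (rule scalar_prod_mult_mat_vec[OF L'c hN p(1)])
    also have "\<dots> = (\<Sum>j\<in>{d}. p $ j * (h \<bullet> col L' j))"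
    proof (rule sum.mono_neutral_right)
      show "\<forall>j\<in>{..<n} - {d}. p $ j * (h \<bullet> col L' j) = 0"
      proof
        fix j assume "j \<in> {..<n} - {d}"
        then show "p $ j * (h \<bullet> col L' j) = 0"
          using p(2)[of j] hlow[of j] by (cases "j < d") auto
      qed
    qed (use dn in auto)
    finally show ?thesis by (simp add: s_def)
  qed
  have H'_lin: "row H' k \<bullet> (L' *\<^sub>v p) = 0"
    if k: "k < dim_row H'" and p: "p \<in> carrier_vec n" "\<And>j. j < d \<Longrightarrow> p $ j = 0" for p k
  proof -
    have "y \<bullet> (L' *\<^sub>v p) = 0" if "y \<in> dual_code N (code_up N d L')" for y
    proof -
      have y: "y \<in> carrier_vec N" using that by (simp add: up)
      show ?thesis unfolding scalar_prod_mult_mat_vec[OF L'c y p(1)]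
        using that p(2)
        by (intro sum.neutral ballI) (auto simp: up not_le[symmetric] simp del: not_le)
    qed
    then show ?thesis using H'up[of "L' *\<^sub>v p"] L'c p(1) k by auto
  qed

  \<comment> \<open>Step I: removal of the known rows\<close>
  define K where "K = submatrix X' {0..<d} UNIV"
  define X1 where "X1 = mat n t (\<lambda>(j, c). if j < d then 0 else X' $$ (j, c))"
  define Z where "Z = Y - submatrix L' UNIV {0..<d} * K"
  have X1c: "X1 \<in> carrier_mat n t" by (simp add: X1_def)
  have LVSX: "L * VS * X = L' * X'"
  proof -
    have "L' * X' = L * VS * (M * X')"
      unfolding L' by (rule assoc_mult_mat[OF LVc Mc X'c])
    also have "M * X' = M * Minv * X"
      unfolding X' by (rule assoc_mult_mat[OF Mc Mic X, symmetric])
    finally show ?thesis unfolding MMi using X by simp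
  qed
  have Z: "Z = L' * X1 + W"
  proof -
    \<comment> \<open>The known rows are padded with zeros to the format of \<open>X'\<close>, so
      that \<open>X'\<close> is the sum of \<open>?X0\<close> and its unknown part
      \<open>X1\<close>, and the subtracted product becomes \<open>L' * ?X0\<close>.\<close>
    let ?X0 = "mat n t (\<lambda>(j, c). if j < d then X' $$ (j, c) else 0)"
    have "X' = X1 + ?X0" using X'c by (intro eq_matI) (auto simp: X1_def)
    then have "L' * X' = L' * X1 + L' * ?X0"
      using mult_add_distrib_mat[OF L'c X1c, of ?X0] by simp
    then have "Y = (L' * X1 + L' * ?X0) + W" unfolding Y LVSX by simp
    moreover have "submatrix L' UNIV {0..<d} * K = L' * ?X0"
      unfolding K_def by (rule submatrix_cols_mult_submatrix_rows[OF L'c X'c]) (use dn in simp)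
    ultimately show ?thesis unfolding Z_def using L'c X1c W by (intro eq_matI) auto
  qed
  have Zc: "Z \<in> carrier_mat N t" using Z L'c X1c W by auto
  have Yc: "Y \<in> carrier_mat N t" using Y W LVc X by simp
  have colZ: "col Z c = L' *\<^sub>v col X1 c + col W c" if "c < t" for c
    using that L'c X1c W unfolding Z by (intro eq_vecI) auto
  have X1d: "col X1 c $ d = X' $$ (d, c)" and X1lt: "\<And>j. j < d \<Longrightarrow> col X1 c $ j = 0"
    if "c < t" for c using that dn by (auto simp: X1_def)
  have hZ: "h \<bullet> col Z c = X' $$ (d, c) * s + h \<bullet> col W c" if c: "c < t" for c
    unfolding colZ[OF c] using h_lin[of "col X1 c"] X1lt[OF c] X1d[OF c] hN L'c X1c W c
    by (subst scalar_prod_add_distrib[of _ N]) auto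
  have H'Z: "row H' k \<bullet> col Z c = row H' k \<bullet> col W c" if k: "k < dim_row H'" and c: "c < t" for k c
    unfolding colZ[OF c] using H'_lin[OF k, of "col X1 c"] X1lt[OF c] rowH' L'c X1c W c
    by (subst scalar_prod_add_distrib[of _ N]) auto

  \<comment> \<open>The outputs of the procedure in terms of \<open>Z\<close>\<close>
  let ?H = "stack_row h H'"
  have Hc: "?H \<in> carrier_mat (Suc (dim_row H')) N"
    using hN H'N by (auto simp: stack_row_def append_rows_def mat_of_row_def)
  have alpha: "row (?H * Z) 0 = vec t (\<lambda>c. h \<bullet> col Z c)"
    using Hc Zc row_stack_row[OF hN H'N] by (intro eq_vecI) auto
  have beta: "submatrix (?H * Z) {1..<dim_row (?H * Z)} UNIV = H' * Z"
  proof -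
    have HZ: "?H * Z \<in> carrier_mat (Suc (dim_row H')) t" using Hc Zc by simp
    have "submatrix (?H * Z) {1..<dim_row (?H * Z)} UNIV =
        mat (dim_row H') t (\<lambda>(k, c). (?H * Z) $$ (Suc k, c))"
      unfolding carrier_matD[OF HZ] by (rule submatrix_drop_first_row[OF HZ])
    also have "\<dots> = H' * Z"
      using Zc by (intro eq_matI) (simp_all add: row_stack_row[OF hN H'N])
    finally show ?thesis .
  qed
  have scal: "(?H *\<^sub>v col L' d) $ 0 = s"
    using row_stack_row(1)[OF hN H'N] by (simp add: s_def)
  have outputs: "syndrome_outputs \<delta> d L' h H' Y K =
      {(1 / s) \<cdot>\<^sub>v (vec t (\<lambda>c. h \<bullet> col Z c) - h \<^sub>v* \<epsilon>) | \<epsilon>.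
        \<epsilon> \<in> carrier_mat N t \<and> hamming_weight \<epsilon> \<le> \<delta> \<and> H' * \<epsilon> = H' * Z}"
    unfolding syndrome_outputs_def Let_def Z_def[symmetric] alpha beta scal
    using Yc by simp

  \<comment> \<open>By \<open>hZ\<close>, \<alpha> is \<open>s\<close> times the demanded row plus
    the contribution of \<open>W\<close>. If \<open>h\<close> cannot distinguish \<epsilon> from
    \<open>W\<close>, subtracting and dividing by \<open>s\<close> leaves the demanded row.\<close>
  have step_III: "(1 / s) \<cdot>\<^sub>v (vec t (\<lambda>c. h \<bullet> col Z c) - h \<^sub>v* \<epsilon>) = row X' d"
    if e: "\<epsilon> \<in> carrier_mat N t" and he: "\<And>c. c < t \<Longrightarrow> h \<bullet> col W c = h \<bullet> col \<epsilon> c" for \<epsilon>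
    using that X'c dn s by (intro eq_vecI) (auto simp: vec_mult_mat_def hZ)

  \<comment> \<open>Soundness: all solutions of Step II agree under \<open>h\<close>\<close>
  have sound: "h \<bullet> col W c = h \<bullet> col \<epsilon> c"
    if e: "\<epsilon> \<in> carrier_mat N t" "hamming_weight \<epsilon> \<le> \<delta>" "H' * \<epsilon> = H' * Z" and c: "c < t" for \<epsilon> c
  proof -
    \<comment> \<open>\<open>W\<close> and \<epsilon> have equal syndromes under \<open>H'\<close>,
      so each column of the difference is orthogonal to the dual of the larger code. Biduality
      returns it to the span of the columns of \<open>L'\<close> from \<open>d\<close> on.\<close>
    have "\<exists>p\<in>carrier_vec n. col W c - col \<epsilon> c = L' *\<^sub>v p \<and> (\<forall>j<n. j \<notin> {d..<n} \<longrightarrow> p $ j = 0)"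
      if c: "c < t" for c
    proof (rule biorthogonal_imp_combination_of_cols[OF L'c])
      show x: "col W c - col \<epsilon> c \<in> carrier_vec N" using W e(1) c by auto
      have "row H' k \<bullet> (col W c - col \<epsilon> c) = 0" if k: "k < dim_row H'" for k
      proof -
        have "row H' k \<bullet> col \<epsilon> c = (H' * \<epsilon>) $$ (k, c)" using k c e(1) by simp
        also have "\<dots> = row H' k \<bullet> col W c" unfolding e(3) using k c Zc H'Z by simp
        finally show ?thesis
          using rowH' W e(1) c by (subst scalar_prod_minus_distrib[of _ N]) auto
      qed
      then have "\<forall>y\<in>dual_code N (code_up N d L'). y \<bullet> (col W c - col \<epsilon> c) = 0"
        using H'up[OF x] by blast
      then show "y \<bullet> (col W c - col \<epsilon> c) = 0"
        if "y \<in> carrier_vec N" "\<forall>j\<in>{d..<n}. y \<bullet> col L' j = 0" for y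
        using that by (auto simp: up)
    qed auto
    then obtain p where p: "\<And>c. c < t \<Longrightarrow> p c \<in> carrier_vec n"
      "\<And>c. c < t \<Longrightarrow> col W c - col \<epsilon> c = L' *\<^sub>v p c"
      "\<And>c j. c < t \<Longrightarrow> j < d \<Longrightarrow> p c $ j = 0"
      using dn by (metis atLeastLessThan_iff less_trans not_le)
    define P where "P = mat n t (\<lambda>(j, c). p c $ j)"
    have Pc: "P \<in> carrier_mat n t" by (simp add: P_def)
    have colP: "col P c = p c" if "c < t" for c using p(1)[OF that] that by (auto simp: P_def)
    have L'P: "L' * P + \<epsilon> = W"
    proof (rule eq_matI)
      fix a c assume "a < dim_row W" "c < dim_col W"
      then have ac: "a < N" "c < t" using W by auto
      have "(L' * P) $$ (a, c) = (L' *\<^sub>v p c) $ a" using ac L'c Pc colP by simp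
      also have "\<dots> = W $$ (a, c) - \<epsilon> $$ (a, c)"
        unfolding p(2)[OF ac(2), symmetric] using ac W e(1) by simp
      finally show "(L' * P + \<epsilon>) $$ (a, c) = W $$ (a, c)" using ac L'c Pc e(1) by simp
    qed (use e(1) W in auto)
    \<comment> \<open>Multiplication by \<open>M\<close> leads from the primed coordinates back to
      actual messages. In those coordinates \<open>V i\<close> sees only the first \<open>d\<close>
      rows, which vanish in \<open>P\<close>.\<close>
    have eq1: "L * VS * (M * P) = L' * P"
      unfolding L' by (rule assoc_mult_mat[OF LVc Mc Pc, symmetric])
    have eq2: "V i * (M * P) = 0\<^sub>m d t"
    proof -
      have "V i * (M * P) = V i * M * P" 
        by (rule assoc_mult_mat[OF Vc Mc Pc, symmetric])
      also have "\<dots> = 0\<^sub>m d t" unfolding VM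
        using Pc p(3) dn by (intro eq_matI) (auto simp: scalar_prod_def P_def intro!: sum.neutral)
      finally show ?thesis .
    qed
    \<comment> \<open>Both equalities evaluate \<open>D\<close> at the same pair: first for the
      message \<open>M * P\<close> with error \<epsilon>, then for the message 0 with error
      \<open>W\<close>. Both weight bounds are needed, since \<epsilon> and \<open>W\<close> each
      serve as an admissible error.\<close>
    have "row R i \<^sub>v* (M * P) = D (W, 0\<^sub>m d t)"
      using bspec[OF bspec[OF D, of "M * P"] e(1)] e(2) Mc Pc unfolding eq1 eq2 L'P by simp
    also have "\<dots> = row R i \<^sub>v* 0\<^sub>m n t"
      using bspec[OF bspec[OF D zero_carrier_mat] W] weight Vc W
        right_mult_zero_mat[OF LVc, of t] by simp
    finally have "unit_vec n d \<^sub>v* P = row R i \<^sub>v* 0\<^sub>m n t"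
      unfolding vec_mult_mat_assoc[OF Rc Mc Pc, symmetric] RM .
    then have "row P d $ c = (row R i \<^sub>v* 0\<^sub>m n t) $ c"
      unfolding unit_vec_mult_mat[OF Pc dn] by simp
    \<comment> \<open>The demand for the zero message is 0, so coefficient \<open>d\<close> is gone
      and \<open>h_lin\<close> gives 0 on the difference.\<close>
    then have "p c $ d = 0" using c dn Rc by (simp add: P_def vec_mult_mat_def)
    then have "h \<bullet> (col W c - col \<epsilon> c) = 0"
      unfolding p(2)[OF c] using h_lin[of "p c"] p(1,3) c by simp
    then show ?thesis
      using hN W e(1) c by (subst (asm) scalar_prod_minus_distrib[of _ N]) auto
  qed

  \<comment> \<open>The true error itself solves Step II. Hence the set of outputs is nonempty, and
    soundness improves from an inclusion to an equality with a singleton.\<close>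
  have H'W: "H' * W = H' * Z"
    using H'Z W Zc by (intro eq_matI) auto
  have "syndrome_outputs \<delta> d L' h H' Y K = {row X' d}"
  proof (intro equalityI subsetI)
    fix v assume "v \<in> syndrome_outputs \<delta> d L' h H' Y K"
    then show "v \<in> {row X' d}" unfolding outputs using step_III sound by blast
  next
    fix v assume "v \<in> {row X' d}"
    then show "v \<in> syndrome_outputs \<delta> d L' h H' Y K"
      unfolding outputs using step_III[OF W refl] W weight H'W
      by (intro CollectI exI[of _ W]) simp
  qed
  then show ?thesis using rowX' unfolding K_def by blast
qed

end
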